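(* The following identity holds: $$\frac{\pi}{3} = \sum_{n=1}^{\infty}\frac{1}{n(2n-1)(4n-3)}.$$ *)

theory Defs
  imports Complex_Main
begin

end

theory Submission
  imports Defs
begin

text \<open>
  Write \<open>k = n - 1\<close> for the index. Partial fractions give
  \<open>1 / ((k+1) (2k+1) (4k+1)) = (8/3) / (4k+1) - 2 / (2k+1) + (1/3) / (k+1)\<close>.
  Half of the first summand, completed by \<open>-(4/3) / (4k+3)\<close>, is \<open>4/3\<close> times a pair of
  consecutive terms of Leibniz' series \<open>1 - 1/3 + 1/5 - \<dots>\<close>, which converges to \<open>\<pi>/4\<close>.
  The remainder \<open>(4/3) / (4k+1) + (4/3) / (4k+3) - 2 / (2k+1) + (1/3) / (k+1)\<close> sums to zero:
  in terms of the harmonic numbers \<open>H\<close>, its first \<open>N\<close> terms add up to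
  \<open>4/3 * (H (4N) - 2 * H (2N) + H N)\<close>. Since \<open>H (2M) - H M\<close> is the partial sum \<open>T (2M)\<close> of the
  alternating harmonic series, this equals \<open>4/3 * (T (4N) - T (2N))\<close>, a difference of two
  sequences with the same limit. The exact formula for the partial sums is
  \<open>partial_sum_eq_Leibniz_and_harmonic\<close>; in the limit only \<open>4/3 * \<pi>/4\<close> survives.
\<close>

text \<open>
  Passing from \<open>N\<close> to \<open>N + 1\<close> adds two terms to \<open>L (2N)\<close>, four to \<open>T (4N)\<close> and two to
  \<open>T (2N)\<close>; the partial fraction decomposition of the new summand matches these increments.
\<close>

lemma partial_sum_eq_Leibniz_and_harmonic:
  fixes L T :: "nat \<Rightarrow> real"
  defines "L \<equiv> \<lambda>N. \<Sum>k<N. (-1) ^ k * (1 / real (k * 2 + 1))"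
    and "T \<equiv> \<lambda>N. \<Sum>k<N. (-1) ^ k * (1 / real (Suc k))"
  shows "(\<Sum>n<N. 1 / (real (Suc n) * (2 * real (Suc n) - 1) * (4 * real (Suc n) - 3)))
           = 4 / 3 * (L (2 * N) + (T (4 * N) - T (2 * N)))"
proof (induction N)
  case 0
  show ?case by (simp add: L_def T_def)
next
  case (Suc N)
  define x where "x = real N"
  have "x \<ge> 0"
    by (simp add: x_def)
  have L: "L (2 * Suc N) = L (2 * N) + (1 / (4 * x + 1) - 1 / (4 * x + 3))"
    by (simp add: L_def x_def algebra_simps)
  have T2: "T (2 * Suc N) = T (2 * N) + (1 / (2 * x + 1) - 1 / (2 * x + 2))"
    by (simp add: T_def x_def algebra_simps)
  have step: "4 * Suc N = Suc (Suc (Suc (Suc (4 * N))))"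
    by simp
  have T4: "T (4 * Suc N) = T (4 * N)
      + (1 / (4 * x + 1) - 1 / (4 * x + 2) + 1 / (4 * x + 3) - 1 / (4 * x + 4))"
    unfolding T_def step sum.lessThan_Suc by (simp add: x_def algebra_simps)
  have partial_fractions: "1 / ((x + 1) * (2 * x + 1) * (4 * x + 1))
      = 4 / 3 * ((1 / (4 * x + 1) - 1 / (4 * x + 3))
          + (1 / (4 * x + 1) - 1 / (4 * x + 2) + 1 / (4 * x + 3) - 1 / (4 * x + 4))
          - (1 / (2 * x + 1) - 1 / (2 * x + 2)))"
  proof -
    have "4 * x + 2 = 2 * (2 * x + 1)" "4 * x + 4 = 4 * (x + 1)" "2 * x + 2 = 2 * (x + 1)"
      by simp_all
    moreover have "x + 1 \<noteq> 0" "2 * x + 1 \<noteq> 0" "4 * x + 1 \<noteq> 0"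
      using \<open>x \<ge> 0\<close> by linarith+
    ultimately show ?thesis
      by (simp only:) (simp add: divide_simps, simp add: algebra_simps)
  qed
  have shift: "real (Suc N) = x + 1" "2 * (x + 1) - 1 = 2 * x + 1"
      "4 * (x + 1) - 3 = 4 * x + 1"
    by (simp_all add: x_def)
  show ?case
    unfolding sum.lessThan_Suc Suc.IH L T2 T4 shift partial_fractions by argo
qed

theorem theorem1:
  shows "(\<lambda>n. 1 / (real (Suc n) * (2 * real (Suc n) - 1) * (4 * real (Suc n) - 3))) sums (pi / 3)"
proof -
  define L T :: "nat \<Rightarrow> real"
    where "L = (\<lambda>N. \<Sum>k<N. (-1) ^ k * (1 / real (k * 2 + 1)))"
      and "T = (\<lambda>N. \<Sum>k<N. (-1) ^ k * (1 / real (Suc k)))"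
  have "(\<lambda>k. (-1) ^ k * (1 / real (k * 2 + 1))) sums (pi / 4)"
    using summable_arctan_series[of 1] pi_series by (simp add: sums_iff)
  then have "L \<longlonglongrightarrow> pi / 4"
    by (simp add: L_def sums_def)
  then have L: "(\<lambda>N. L (2 * N)) \<longlonglongrightarrow> pi / 4"
    by (rule filterlim_compose) (rule mult_nat_left_at_top, simp)
  have "summable (\<lambda>k. (-1) ^ k * (1 / real (Suc k)))"
  proof (rule summable_Leibniz(1))
    show "(\<lambda>k. 1 / real (Suc k)) \<longlonglongrightarrow> 0"
      using LIMSEQ_inverse_real_of_nat by (simp add: inverse_eq_divide)
    show "monoseq (\<lambda>k. 1 / real (Suc k))"
      by (rule decseq_imp_monoseq) (simp add: decseq_def frac_le)
  qed
  then obtain l where T: "T \<longlonglongrightarrow> l"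
    by (auto simp: T_def summable_def sums_def)
  have "(\<lambda>N. T (4 * N)) \<longlonglongrightarrow> l" "(\<lambda>N. T (2 * N)) \<longlonglongrightarrow> l"
    by (rule filterlim_compose[OF T], rule mult_nat_left_at_top, simp)+
  with L have "(\<lambda>N. 4 / 3 * (L (2 * N) + (T (4 * N) - T (2 * N)))) \<longlonglongrightarrow> 4 / 3 * (pi / 4 + (l - l))"
    by (intro tendsto_intros)
  then show ?thesis
    unfolding sums_def partial_sum_eq_Leibniz_and_harmonic L_def T_def by simp
qed

end
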